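(* Let $\tau\in L^2(\mathbb{Z})$ be the element $$\tau=\sum_{n=1}^\infty \frac{(-1)^{n+1}}{n}\,(q^n-q^{-n}).$$ Then $\exp(\tau)=q$ in the following sense: the convolution powers $\tau,\tau^2,\tau^3,\ldots$ all lie in $L^2(\mathbb{Z})$, and the series $$1+\tau+\frac{\tau^2}{2!}+\frac{\tau^3}{3!}+\cdots$$ converges in $L^2(\mathbb{Z})$ to $q$.
   Context: $L^2(\mathbb{Z})$ denotes the Hilbert space of square-summable complex sequences $\psi=(\psi_n)_{n\in\mathbb{Z}}$. Such a $\psi$ is written as a formal Laurent series $\sum_{n\in\mathbb{Z}}\psi_n q^n$, so that $q^n$ denotes the sequence that is $1$ at index $n$ and $0$ elsewhere, and $1=q^0$. (Here $q$ is thought of as a generator of the group $P_2\cong\mathbb{Z}$ of pure braids on two strands, and $L^2(\mathbb{Z})$ is the space $\mathcal{P}_2$ of formal infinite sums of elements of $P_2$ with square-summable coefficients.) Thus $\tau$ is the sequence with coefficient $0$ at index $0$ and coefficient $(-1)^{n+1}/n$ at each index $n\neq 0$ (positive or negative). Products are convolutions, $(\phi\psi)_n=\sum_{k\in\mathbb{Z}}\phi_k\psi_{n-k}$, corresponding to multiplication of Laurent series in $q$. The powers are defined by $\tau^1=\tau$ and $\tau^m=\tau^{m-1}\tau$ for $m\ge 2$. *)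

theory Defs
  imports "HOL-Analysis.Analysis"
begin

definition l2 :: "(int \<Rightarrow> complex) set" where
  "l2 = {\<psi>. (\<lambda>n. (cmod (\<psi> n))\<^sup>2) summable_on UNIV}"

text \<open>Meaningful on \<open>l2\<close> only: \<open>infsum\<close> returns 0 when the family is not summable.\<close>

definition l2_norm :: "(int \<Rightarrow> complex) \<Rightarrow> real" where
  "l2_norm \<psi> = sqrt (\<Sum>\<^sub>\<infinity>n. (cmod (\<psi> n))\<^sup>2)"

text \<open>
  Convergence of the series \<open>\<Sum>m. f m\<close> to \<open>s\<close> in the norm of \<open>l2\<close>.  Membership in \<open>l2\<close> is
  required explicitly, so that \<open>l2_norm\<close> is only ever taken of elements of \<open>l2\<close>.
\<close>

definition l2_sums :: "(nat \<Rightarrow> int \<Rightarrow> complex) \<Rightarrow> (int \<Rightarrow> complex) \<Rightarrow> bool" where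
  "l2_sums f s \<longleftrightarrow> (\<forall>m. f m \<in> l2) \<and> s \<in> l2 \<and>
     (\<lambda>N. l2_norm (\<lambda>n. (\<Sum>m<N. f m n) - s n)) \<longlonglongrightarrow> 0"

text \<open>The monomial \<open>q\<close> to the power \<open>k\<close>, as the sequence of its Laurent coefficients.\<close>

definition q_power :: "int \<Rightarrow> int \<Rightarrow> complex" where
  "q_power k n = (if n = k then 1 else 0)"

text \<open>For factors in \<open>l2\<close> the sum converges absolutely, by Cauchy--Schwarz.\<close>

definition conv :: "(int \<Rightarrow> complex) \<Rightarrow> (int \<Rightarrow> complex) \<Rightarrow> int \<Rightarrow> complex" where
  "conv \<phi> \<psi> n = (\<Sum>\<^sub>\<infinity>k. \<phi> k * \<psi> (n - k))"

fun conv_power :: "(int \<Rightarrow> complex) \<Rightarrow> nat \<Rightarrow> int \<Rightarrow> complex" where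
  "conv_power \<psi> 0 = q_power 0"
| "conv_power \<psi> (Suc 0) = \<psi>"
| "conv_power \<psi> (Suc (Suc m)) = conv (conv_power \<psi> (Suc m)) \<psi>"

text \<open>
  The coefficient of \<open>q\<close> to the power \<open>-n\<close>, for \<open>n > 0\<close>, is \<open>- (-1) ^ (n + 1) / n\<close>; as the parities
  of \<open>n\<close> and \<open>-n\<close> agree, one formula covers all nonzero indices.
\<close>

definition tau :: "int \<Rightarrow> complex" where
  "tau n = (if n = 0 then 0 else (- 1) powi (n + 1) / of_int n)"

end

theory Submission imports Defs begin

text \<open>
  The sequence \<open>tau\<close> consists of the Fourier coefficients of \<open>t \<mapsto> \<i> t\<close> on \<open>[-\<pi>, \<pi>]\<close>.  Euler's value
  of \<open>\<zeta>(2)\<close> is exactly Parseval's identity for this function, so its Fourier series converges to it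
  in mean square; hence convolving the coefficients of any continuous \<open>f\<close> with \<open>tau\<close> gives those of
  \<open>t \<mapsto> f t * \<i> t\<close>, and the \<open>m\<close>-th power of \<open>tau\<close> belongs to \<open>(\<i> t) ^ m\<close>.  The exponential series
  of \<open>\<i> t\<close> converges uniformly on \<open>[-\<pi>, \<pi>]\<close> to \<open>cis t\<close>, whose coefficient sequence is \<open>q\<close>, and
  Bessel's inequality carries uniform convergence over to \<open>l2\<close>.
\<close>

text \<open>Dividing by \<open>2 * pi\<close> makes the functions \<open>cis (k * t)\<close>
  orthonormal, and the sign in the exponent lets \<open>cis (k * t)\<close> stand for the monomial
  \<open>q\<close> to the power \<open>k\<close>. With the same normalisation
  \<open>mean_square\<close> is the squared norm of the function side.\<close>

definition fourier_coeff :: "(real \<Rightarrow> complex) \<Rightarrow> int \<Rightarrow> complex" where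
  "fourier_coeff f n = integral {-pi..pi} (\<lambda>t. f t * cis (- (of_int n * t))) / (2 * of_real pi)"

definition mean_square :: "(real \<Rightarrow> complex) \<Rightarrow> real" where
  "mean_square f = integral {-pi..pi} (\<lambda>t. (cmod (f t))\<^sup>2) / (2 * pi)"

section \<open>Exponentials and the algebra of Fourier coefficients\<close>

lemma cis_has_vector_derivative:
  "((\<lambda>t. cis (c * t)) has_vector_derivative (\<i> * of_real c * cis (c * t))) (at t within S)"
  unfolding has_vector_derivative_def
  by (rule derivative_eq_intros refl)+ (auto simp: scaleR_conv_of_real algebra_simps)

lemma integral_cis:
  "integral {-pi..pi} (\<lambda>t. cis (of_int k * t)) = (if k = 0 then 2 * of_real pi else 0)"
proof (cases "k = 0")
  case True
  then show ?thesis
    by (simp add: content_real scaleR_conv_of_real)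
next
  case False
  let ?G = "\<lambda>t. cis (of_int k * t) / (\<i> * of_int k)"
  have "((\<lambda>t. cis (of_int k * t)) has_integral (?G pi - ?G (-pi))) {-pi..pi}"
  proof (rule fundamental_theorem_of_calculus)
    fix t :: real
    have "((\<lambda>t. cis (of_int k * t) * inverse (\<i> * of_int k)) has_vector_derivative
            (\<i> * of_real (of_int k) * cis (of_int k * t)) * inverse (\<i> * of_int k)) (at t within {-pi..pi})"
      by (intro has_vector_derivative_mult_left cis_has_vector_derivative)
    then show "(?G has_vector_derivative cis (of_int k * t)) (at t within {-pi..pi})"
      using False by (simp add: field_simps)
  qed auto
  \<comment> \<open>The endpoints differ by \<open>k\<close> full turns, so the antiderivative takes
    equal values there.\<close>
  moreover have "cis (of_int k * pi) = cis (of_int k * (-pi))"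
    using cis_multiple_2pi[of "of_int k"] cis_mult[of "of_int k * (-pi)" "2 * pi * of_int k"]
    by (simp add: algebra_simps)
  ultimately show ?thesis
    using False by (simp add: integral_unique)
qed

lemma fourier_coeff_diff:
  assumes "continuous_on {-pi..pi} f" "continuous_on {-pi..pi} g"
  shows "fourier_coeff (\<lambda>t. f t - g t) n = fourier_coeff f n - fourier_coeff g n"
  unfolding fourier_coeff_def left_diff_distrib diff_divide_distrib[symmetric]
  by (subst integral_diff) (auto intro!: integrable_continuous_interval continuous_intros assms)

lemma fourier_coeff_cmult: "fourier_coeff (\<lambda>t. c * f t) n = c * fourier_coeff f n"
  unfolding fourier_coeff_def by (simp add: mult.assoc)

lemma fourier_coeff_sum:
  assumes "finite A" "\<And>m. m \<in> A \<Longrightarrow> continuous_on {-pi..pi} (f m)"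
  shows "fourier_coeff (\<lambda>t. \<Sum>m\<in>A. f m t) n = (\<Sum>m\<in>A. fourier_coeff (f m) n)"
  unfolding fourier_coeff_def sum_distrib_right
  by (subst integral_sum)
     (auto intro!: integrable_continuous_interval continuous_intros assms simp: sum_divide_distrib)

lemma fourier_coeff_diff_sum:
  assumes "finite A" "continuous_on {-pi..pi} f" "\<And>m. m \<in> A \<Longrightarrow> continuous_on {-pi..pi} (g m)"
  shows "fourier_coeff (\<lambda>t. f t - (\<Sum>m\<in>A. c m * g m t)) n =
         fourier_coeff f n - (\<Sum>m\<in>A. c m * fourier_coeff (g m) n)"
proof -
  have cont: "continuous_on {-pi..pi} (\<lambda>t. c m * g m t)" if "m \<in> A" for m
    by (intro continuous_intros assms that)
  have "fourier_coeff (\<lambda>t. \<Sum>m\<in>A. c m * g m t) n = (\<Sum>m\<in>A. c m * fourier_coeff (g m) n)"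
    by (subst fourier_coeff_sum[OF assms(1) cont]) (auto simp: fourier_coeff_cmult)
  moreover have "continuous_on {-pi..pi} (\<lambda>t. \<Sum>m\<in>A. c m * g m t)"
    by (intro continuous_on_sum cont)
  ultimately show ?thesis
    by (simp add: fourier_coeff_diff assms(2))
qed

text \<open>The exponentials in the two factors combine under the integral. For trigonometric
  polynomials this already is the convolution rule.\<close>

lemma fourier_coeff_cis_shift:
  "fourier_coeff (\<lambda>t. f t * cis (of_int k * t)) n = fourier_coeff f (n - k)"
  unfolding fourier_coeff_def by (simp add: mult.assoc cis_mult algebra_simps)

lemma fourier_coeff_cis: "fourier_coeff (\<lambda>t. cis (of_int k * t)) = q_power k"
proof
  fix n
  show "fourier_coeff (\<lambda>t. cis (of_int k * t)) n = q_power k n"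
    using integral_cis[of "k - n"]
    by (simp add: fourier_coeff_def q_power_def cis_mult algebra_simps)
qed

section \<open>Mean squares and Bessel's inequality\<close>

lemma mean_square_nonneg: "0 \<le> mean_square f"
proof -
  have "0 \<le> integral {-pi..pi} (\<lambda>t. (cmod (f t))\<^sup>2)"
    \<comment> \<open>A non-integrable function has \<open>integral\<close> 0 by convention, which
      settles the second case.\<close>
    by (cases "(\<lambda>t. (cmod (f t))\<^sup>2) integrable_on {-pi..pi}")
       (auto intro: integral_nonneg simp: not_integrable_integral)
  then show ?thesis
    by (simp add: mean_square_def)
qed

lemma mean_square_le:
  assumes "continuous_on {-pi..pi} f" "\<And>t. t \<in> {-pi..pi} \<Longrightarrow> cmod (f t) \<le> e"
  shows "mean_square f \<le> e\<^sup>2"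
proof -
  have "integral {-pi..pi} (\<lambda>t. (cmod (f t))\<^sup>2) \<le> integral {-pi..pi} (\<lambda>t. e\<^sup>2)"
    by (rule integral_le)
       (auto intro!: integrable_continuous_interval continuous_intros assms power_mono)
  then show ?thesis
    by (simp add: mean_square_def field_simps)
qed

text \<open>Pythagoras for one unit vector: the subtracted term is the orthogonal projection of
  \<open>f\<close> onto \<open>cis (n * t)\<close>.\<close>

lemma mean_square_subtract_coeff:
  assumes "continuous_on {-pi..pi} f"
  shows "mean_square (\<lambda>t. f t - fourier_coeff f n * cis (of_int n * t)) =
         mean_square f - (cmod (fourier_coeff f n))\<^sup>2"
proof -
  define c where "c = fourier_coeff f n"
  have eq: "(cmod (f t - c * cis (of_int n * t)))\<^sup>2 =
      (cmod (f t))\<^sup>2 + (cmod c)\<^sup>2 - 2 * Re (cnj c * (f t * cis (- (of_int n * t))))" for t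
  proof -
    define e where "e = cis (of_int n * t)"
    have e: "cis (- (of_int n * t)) = cnj e" "cmod e = 1"
      by (simp_all add: e_def cis_cnj)
    have "(cmod (f t - c * e))\<^sup>2 = (cmod (f t))\<^sup>2 + (cmod (c * e))\<^sup>2 - 2 * Re (cnj (c * e) * f t)"
      by (simp only: cmod_power2) (simp add: power2_eq_square algebra_simps)
    then show ?thesis
      unfolding e_def[symmetric] e(1) by (simp add: norm_mult e(2) algebra_simps)
  qed
  have int: "(\<lambda>t. cnj c * (f t * cis (- (of_int n * t)))) integrable_on {-pi..pi}"
    by (intro integrable_continuous_interval continuous_intros assms)
  \<comment> \<open>The remaining integral is that of the coefficient \<open>c\<close> itself. The
    cross term, taken twice, thus removes two copies of what the constant term adds, leaving a net
    loss of one.\<close>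
  have "integral {-pi..pi} (\<lambda>t. Re (cnj c * (f t * cis (- (of_int n * t))))) =
        Re (cnj c * (2 * of_real pi * c))"
    using integral_linear[OF int bounded_linear_Re]
    by (simp add: o_def c_def fourier_coeff_def)
  also have "\<dots> = 2 * pi * (cmod c)\<^sup>2"
    unfolding cmod_power2 by (simp add: power2_eq_square algebra_simps)
  finally have "integral {-pi..pi} (\<lambda>t. 2 * Re (cnj c * (f t * cis (- (of_int n * t))))) =
        2 * (2 * pi * (cmod c)\<^sup>2)"
    by (simp only: integral_mult_right)
  moreover have "integral {-pi..pi} (\<lambda>t. (cmod (f t - c * cis (of_int n * t)))\<^sup>2) =
      integral {-pi..pi} (\<lambda>t. (cmod (f t))\<^sup>2) + integral {-pi..pi} (\<lambda>t. (cmod c)\<^sup>2)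
      - integral {-pi..pi} (\<lambda>t. 2 * Re (cnj c * (f t * cis (- (of_int n * t)))))"
    unfolding eq
    by (subst integral_diff integral_add;
        (intro integrable_continuous_interval continuous_intros assms)?)+ simp
  ultimately have "integral {-pi..pi} (\<lambda>t. (cmod (f t - c * cis (of_int n * t)))\<^sup>2) =
      integral {-pi..pi} (\<lambda>t. (cmod (f t))\<^sup>2) - 2 * pi * (cmod c)\<^sup>2"
    by (simp only: integral_const) simp
  then show ?thesis
    unfolding c_def[symmetric] mean_square_def by (simp add: diff_divide_distrib)
qed

text \<open>By orthogonality the removed exponentials have no component at \<open>n\<close>. Hence
  frequencies can be removed one at a time, each with its original coefficient.\<close>

lemma fourier_coeff_remainder:
  assumes "finite A" "continuous_on {-pi..pi} f" "n \<notin> A"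
  shows "fourier_coeff (\<lambda>t. f t - (\<Sum>k\<in>A. fourier_coeff f k * cis (of_int k * t))) n =
         fourier_coeff f n"
proof -
  have "q_power k n = 0" if "k \<in> A" for k
    using that assms(3) by (auto simp: q_power_def)
  then show ?thesis
    using assms
    by (subst fourier_coeff_diff_sum) (auto intro!: continuous_intros simp: fourier_coeff_cis)
qed

text \<open>Iterated Pythagoras. Nonnegativity of the left side yields Bessel's inequality; the
  equality measures the error of a truncated Fourier series.\<close>

lemma mean_square_remainder:
  assumes "finite A" "continuous_on {-pi..pi} f"
  shows "mean_square (\<lambda>t. f t - (\<Sum>k\<in>A. fourier_coeff f k * cis (of_int k * t))) =
         mean_square f - (\<Sum>k\<in>A. (cmod (fourier_coeff f k))\<^sup>2)"
  using assms(1)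
proof induction
  case empty
  show ?case by simp
next
  case (insert n A)
  let ?R = "\<lambda>t. f t - (\<Sum>k\<in>A. fourier_coeff f k * cis (of_int k * t))"
  have R: "continuous_on {-pi..pi} ?R"
    by (intro continuous_intros assms)
  have "mean_square (\<lambda>t. f t - (\<Sum>k\<in>insert n A. fourier_coeff f k * cis (of_int k * t))) =
        mean_square (\<lambda>t. ?R t - fourier_coeff ?R n * cis (of_int n * t))"
    unfolding fourier_coeff_remainder[OF insert.hyps(1) assms(2) insert.hyps(2)]
    by (simp add: sum.insert[OF insert.hyps] diff_diff_eq add.commute)
  also have "\<dots> = mean_square ?R - (cmod (fourier_coeff ?R n))\<^sup>2"
    by (rule mean_square_subtract_coeff[OF R])
  finally show ?case
    using insert assms(2) by (simp add: fourier_coeff_remainder)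
qed

lemma bessel_inequality:
  assumes "finite A" "continuous_on {-pi..pi} f"
  shows "(\<Sum>k\<in>A. (cmod (fourier_coeff f k))\<^sup>2) \<le> mean_square f"
  using mean_square_remainder[OF assms]
    mean_square_nonneg[of "\<lambda>t. f t - (\<Sum>k\<in>A. fourier_coeff f k * cis (of_int k * t))"]
  by linarith

lemma fourier_coeff_in_l2:
  assumes "continuous_on {-pi..pi} f"
  shows "fourier_coeff f \<in> l2"
proof -
  have "bdd_above (sum (\<lambda>n. (cmod (fourier_coeff f n))\<^sup>2) ` {F. F \<subseteq> UNIV \<and> finite F})"
    by (rule bdd_aboveI2[where M = "mean_square f"]) (simp add: bessel_inequality assms)
  then have "(\<lambda>n. (cmod (fourier_coeff f n))\<^sup>2) summable_on UNIV"
    by (intro nonneg_bdd_above_summable_on) simp_all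
  then show ?thesis
    by (simp add: l2_def)
qed

text \<open>Bessel's inequality turns a uniform bound on a function into an \<open>l2\<close> bound
  on its coefficients.\<close>

lemma l2_norm_fourier_coeff_le:
  assumes "continuous_on {-pi..pi} f" "\<And>t. t \<in> {-pi..pi} \<Longrightarrow> cmod (f t) \<le> e" "0 \<le> e"
  shows "l2_norm (fourier_coeff f) \<le> e"
proof -
  have "(\<Sum>\<^sub>\<infinity>n. (cmod (fourier_coeff f n))\<^sup>2) \<le> mean_square f"
    using fourier_coeff_in_l2[OF assms(1)]
    by (intro infsum_le_finite_sums bessel_inequality assms) (auto simp: l2_def)
  also have "\<dots> \<le> e\<^sup>2"
    by (intro mean_square_le assms)
  finally show ?thesis
    unfolding l2_norm_def using assms(3) by (simp add: real_le_lsqrt)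
qed

section \<open>Coefficients of a product as a convolution\<close>

text \<open>
  A weak form of the Cauchy--Schwarz inequality; the summand 1 avoids a separate treatment of
  \<open>mean_square f = 0\<close>.
\<close>

lemma fourier_coeff_mult_bound:
  assumes f: "continuous_on {-pi..pi} f" and g: "continuous_on {-pi..pi} g"
  shows "(cmod (fourier_coeff (\<lambda>t. f t * g t) n))\<^sup>2 \<le> (mean_square f + 1) * mean_square g"
proof (cases "fourier_coeff (\<lambda>t. f t * g t) n = 0")
  case True
  then show ?thesis by (simp add: mean_square_nonneg)
next
  case False
  define x where "x = cmod (fourier_coeff (\<lambda>t. f t * g t) n)"
  \<comment> \<open>The weight for the AM-GM inequality below: it keeps
    \<open>e * mean_square f\<close> at most \<open>x\<close>, so one of the two copies of
    \<open>x\<close> in \<open>2 * x\<close> is absorbed and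
    \<open>x \<le> mean_square g / e\<close> remains.\<close>
  define e where "e = x / (mean_square f + 1)"
  have x: "x > 0" using False by (simp add: x_def)
  have e: "e > 0" using x mean_square_nonneg[of f] by (simp add: e_def add_nonneg_pos)
  have amgm: "a * b \<le> (e * a\<^sup>2 + b\<^sup>2 / e) / 2" for a b :: real
    using e zero_le_power2[of "e * a - b"] by (simp add: field_simps power2_eq_square)
  have "cmod (integral {-pi..pi} (\<lambda>t. f t * g t * cis (- (of_int n * t)))) \<le>
        integral {-pi..pi} (\<lambda>t. (e * (cmod (f t))\<^sup>2 + (cmod (g t))\<^sup>2 / e) / 2)"
    using e
    by (intro integral_norm_bound_integral integrable_continuous_interval continuous_intros f g)
       (use amgm in \<open>simp_all add: norm_mult\<close>)
  also have "\<dots> = (e * integral {-pi..pi} (\<lambda>t. (cmod (f t))\<^sup>2)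
        + integral {-pi..pi} (\<lambda>t. (cmod (g t))\<^sup>2) / e) / 2"
    using e
    by (simp, subst integral_add)
       (auto intro!: integrable_continuous_interval continuous_intros f g)
  finally have "2 * x \<le> e * mean_square f + mean_square g / e"
    by (simp add: x_def mean_square_def fourier_coeff_def norm_divide norm_mult field_simps)
  moreover have "e * mean_square f \<le> x"
    using x mean_square_nonneg[of f] by (simp add: e_def field_simps)
  ultimately have "x \<le> mean_square g / e"
    by linarith
  then show ?thesis
    using e x mean_square_nonneg[of f] unfolding x_def[symmetric]
    by (simp add: e_def field_simps power2_eq_square)
qed

text \<open>Replacing \<open>g\<close> by a finite Fourier sum makes the formula exact, by the shift
  rule. The error is a coefficient of \<open>f\<close> times the remainder of \<open>g\<close>, and
  Parseval sends the mean square of that remainder to 0.\<close>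

lemma fourier_coeff_mult_has_sum:
  assumes f: "continuous_on {-pi..pi} f" and g: "continuous_on {-pi..pi} g"
    and parseval: "((\<lambda>k. (cmod (fourier_coeff g k))\<^sup>2) has_sum mean_square g) UNIV"
  shows "((\<lambda>k. fourier_coeff f k * fourier_coeff g (n - k)) has_sum
          fourier_coeff (\<lambda>t. f t * g t) n) UNIV"
proof -
  let ?R = "\<lambda>A t. g t - (\<Sum>k\<in>A. fourier_coeff g k * cis (of_int k * t))"
  let ?F = "finite_subsets_at_top (UNIV :: int set)"
  let ?D = "\<lambda>A. fourier_coeff (\<lambda>t. f t * g t) n - (\<Sum>k\<in>A. fourier_coeff g k * fourier_coeff f (n - k))"
  have D: "?D A = fourier_coeff (\<lambda>t. f t * ?R A t) n" if "finite A" for A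
  proof -
    have "fourier_coeff (\<lambda>t. f t * ?R A t) n =
          fourier_coeff (\<lambda>t. f t * g t - (\<Sum>k\<in>A. fourier_coeff g k * (f t * cis (of_int k * t)))) n"
      by (simp add: right_diff_distrib sum_distrib_left mult_ac)
    also have "\<dots> = ?D A"
      using that f g
      by (subst fourier_coeff_diff_sum)
         (auto intro!: continuous_intros simp: fourier_coeff_cis_shift)
    finally show ?thesis by simp
  qed
  let ?B = "\<lambda>A. (mean_square f + 1) * (mean_square g - (\<Sum>k\<in>A. (cmod (fourier_coeff g k))\<^sup>2))"
  have "(?B \<longlongrightarrow> (mean_square f + 1) * (mean_square g - mean_square g)) ?F"
    using parseval unfolding has_sum_def by (intro tendsto_intros)
  then have B: "(?B \<longlongrightarrow> 0) ?F"
    by simp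
  have "\<forall>\<^sub>F A in ?F. norm ((cmod (?D A))\<^sup>2) \<le> ?B A"
  proof (rule eventually_finite_subsets_at_top_weakI)
    fix A :: "int set" assume A: "finite A"
    have "continuous_on {-pi..pi} (?R A)"
      by (intro continuous_intros g)
    from fourier_coeff_mult_bound[OF f this, of n]
    show "norm ((cmod (?D A))\<^sup>2) \<le> ?B A"
      unfolding D[OF A] mean_square_remainder[OF A g] by simp
  qed
  then have "((\<lambda>A. (cmod (?D A))\<^sup>2) \<longlongrightarrow> 0) ?F"
    using B by (rule Lim_null_comparison)
  from tendsto_real_sqrt[OF this] have "(?D \<longlongrightarrow> 0) ?F"
    unfolding real_sqrt_zero real_sqrt_abs abs_norm_cancel by (rule tendsto_norm_zero_cancel)
  then have "((\<lambda>A. fourier_coeff (\<lambda>t. f t * g t) n - ?D A) \<longlongrightarrow>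
      fourier_coeff (\<lambda>t. f t * g t) n - 0) ?F"
    by (intro tendsto_intros)
  then have "((\<lambda>k. fourier_coeff g k * fourier_coeff f (n - k)) has_sum
          fourier_coeff (\<lambda>t. f t * g t) n) UNIV"
    by (simp add: has_sum_def)
  \<comment> \<open>The reflection of \<open>k\<close> to \<open>n - k\<close> moves the shifted
    index from \<open>f\<close> to \<open>g\<close>.\<close>
  then show ?thesis
    by (rule has_sum_reindex_bij_witness[of UNIV "\<lambda>k. n - k" "\<lambda>k. n - k", THEN iffD1, rotated -1])
       (simp_all add: mult.commute)
qed

section \<open>The sawtooth function and Parseval's identity for it\<close>

lemma fourier_coeff_sawtooth: "fourier_coeff (\<lambda>t. \<i> * of_real t) = tau"
proof
  fix n
  show "fourier_coeff (\<lambda>t. \<i> * of_real t) n = tau n"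
  proof (cases "n = 0")
    case True
    have "((\<lambda>t. \<i> * of_real t) has_integral
        (\<i> * of_real (pi\<^sup>2 / 2) - \<i> * of_real ((-pi)\<^sup>2 / 2))) {-pi..pi}"
    proof (rule fundamental_theorem_of_calculus)
      fix t :: real
      have "((\<lambda>t. t\<^sup>2 / 2) has_real_derivative t) (at t within {-pi..pi})"
        by (auto intro!: derivative_eq_intros)
      then show "((\<lambda>t. \<i> * of_real (t\<^sup>2 / 2)) has_vector_derivative \<i> * of_real t) (at t within {-pi..pi})"
        by (intro has_vector_derivative_mult_right has_vector_derivative_of_real)
           (simp add: has_real_derivative_iff_has_vector_derivative)
    qed auto
    then have "integral {-pi..pi} (\<lambda>t. \<i> * of_real t) = 0"
      by (simp only: integral_unique) simp
    then show ?thesis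
      using True by (simp add: fourier_coeff_def tau_def)
  next
    case False
    \<comment> \<open>Found by integration by parts. Both exponentials at the endpoints equal
      \<open>(-1) powi n\<close>, so the term with \<open>\<i>\<close> cancels and the jump of the
      sawtooth leaves \<open>- 2 * pi * (-1) powi n / n\<close>.\<close>
    let ?G = "\<lambda>t. (- of_real t / of_int n + \<i> / (of_int n)\<^sup>2) * cis (- of_int n * t)"
    have "((\<lambda>t. \<i> * of_real t * cis (- (of_int n * t))) has_integral (?G pi - ?G (-pi))) {-pi..pi}"
    proof (rule fundamental_theorem_of_calculus)
      fix t :: real
      have "((\<lambda>t. - of_real t / of_int n + \<i> / (of_int n)\<^sup>2) has_vector_derivative
              (- 1 / of_int n)) (at t within {-pi..pi})"
        unfolding has_vector_derivative_def
        by (rule derivative_eq_intros refl)+ (use False in \<open>auto simp: scaleR_conv_of_real field_simps\<close>)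
      from has_vector_derivative_mult[OF this cis_has_vector_derivative[of "- of_int n"]]
      show "(?G has_vector_derivative \<i> * of_real t * cis (- (of_int n * t))) (at t within {-pi..pi})"
        by (rule has_vector_derivative_eq_rhs)
           (use False in \<open>simp add: divide_simps, simp add: power2_eq_square algebra_simps\<close>)
    qed auto
    then have "integral {-pi..pi} (\<lambda>t. \<i> * of_real t * cis (- (of_int n * t))) = ?G pi - ?G (-pi)"
      by (rule integral_unique)
    moreover have "cis (of_int n * pi) = (-1) powi n" "cis (- (of_int n * pi)) = (-1) powi n"
      using cis_power_int[of pi n] cis_power_int[of "-pi" n]
      by (simp_all add: minus_cis[of 0, simplified] flip: cis_cnj)
    ultimately show ?thesis
      using False by (simp add: fourier_coeff_def tau_def power_int_add) (simp add: field_simps)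
  qed
qed

lemma mean_square_sawtooth: "mean_square (\<lambda>t. \<i> * of_real t) = pi\<^sup>2 / 3"
proof -
  have "((\<lambda>t. t\<^sup>2) has_integral (pi ^ 3 / 3 - (-pi) ^ 3 / 3)) {-pi..pi}"
    by (rule fundamental_theorem_of_calculus)
       (auto intro!: derivative_eq_intros simp flip: has_real_derivative_iff_has_vector_derivative)
  then show ?thesis
    by (simp add: mean_square_def norm_mult integral_unique power2_eq_square power3_eq_cube)
qed

lemma tau_has_sum_norm_square: "((\<lambda>n. (cmod (tau n))\<^sup>2) has_sum (pi\<^sup>2 / 3)) UNIV"
proof -
  let ?t = "\<lambda>n. (cmod (tau n))\<^sup>2"
  \<comment> \<open>This includes \<open>n = 0\<close>, where division by zero gives 0 on the
    right.\<close>
  have tau: "?t n = 1 / (of_int n)\<^sup>2" for n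
    by (simp add: tau_def norm_divide norm_power_int power_divide)
  have "(\<lambda>n. 1 / (real n + 1)\<^sup>2) sums (pi\<^sup>2 / 6)"
    using inverse_squares_sums by (simp add: add.commute)
  then have half: "((\<lambda>n. 1 / (real n + 1)\<^sup>2) has_sum (pi\<^sup>2 / 6)) UNIV"
    by (intro norm_summable_imp_has_sum) (auto simp: sums_iff)
  have pos: "(?t has_sum (pi\<^sup>2 / 6)) {0<..}"
    using half
    by (subst has_sum_reindex_bij_witness[of "{0<..}" "\<lambda>n. int n + 1" "\<lambda>k. nat (k - 1)" UNIV
          "\<lambda>n. 1 / (real n + 1)\<^sup>2"]) (auto simp: tau)
  \<comment> \<open>The terms are even in \<open>n\<close>, so the negative indices contribute a
    second copy of Euler's sum.\<close>
  then have neg: "(?t has_sum (pi\<^sup>2 / 6)) {..<0}"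
    by (subst has_sum_reindex_bij_witness[of "{..<0}" uminus uminus "{0<..}" ?t]) (auto simp: tau)
  have "(?t has_sum (pi\<^sup>2 / 6 + pi\<^sup>2 / 6)) ({0<..} \<union> {..<0})"
    by (rule has_sum_Un_disjoint[OF pos neg]) auto
  then have "(?t has_sum (pi\<^sup>2 / 3)) ({0<..} \<union> {..<0})"
    by simp
  then show ?thesis
    by (rule has_sum_cong_neutral[THEN iffD1, rotated -1]) (auto simp: tau)
qed

section \<open>Powers of \<open>tau\<close> and the exponential series\<close>

text \<open>Each new factor on the right is \<open>tau\<close>, so Parseval for the sawtooth alone
  carries the induction; the left factor enters only as a continuous function.\<close>

lemma conv_power_tau: "conv_power tau m = fourier_coeff (\<lambda>t. (\<i> * of_real t) ^ m)"
proof (induction tau m rule: conv_power.induct)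
  case 1
  then show ?case using fourier_coeff_cis[of 0] by simp
next
  case 2
  then show ?case by (simp add: fourier_coeff_sawtooth)
next
  case (3 m)
  have "((\<lambda>k. fourier_coeff (\<lambda>t. (\<i> * of_real t) ^ Suc m) k * tau (n - k)) has_sum
          fourier_coeff (\<lambda>t. (\<i> * of_real t) ^ Suc m * (\<i> * of_real t)) n) UNIV" for n
    unfolding fourier_coeff_sawtooth[symmetric]
    by (intro fourier_coeff_mult_has_sum continuous_intros)
       (simp add: fourier_coeff_sawtooth mean_square_sawtooth tau_has_sum_norm_square)
  then show ?case
    using 3 by (auto simp: conv_def fun_eq_iff infsumI mult_ac)
qed

text \<open>On this interval the exponential series at \<open>pi\<close> is a convergent
  majorant.\<close>

lemma uniform_limit_cis_series:
  "uniform_limit {-pi..pi} (\<lambda>N t. \<Sum>m<N. (\<i> * of_real t) ^ m / fact m) cis sequentially"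
proof -
  have "uniform_limit {-pi..pi} (\<lambda>N t. \<Sum>m<N. (\<i> * of_real t) ^ m / fact m)
          (\<lambda>t. \<Sum>m. (\<i> * of_real t) ^ m / fact m) sequentially"
  proof (rule Weierstrass_m_test[where M = "\<lambda>m. pi ^ m / fact m"])
    show "cmod ((\<i> * of_real t) ^ m / fact m) \<le> pi ^ m / fact m"
      if "t \<in> {-pi..pi}" for m and t :: real
      using that by (auto simp: norm_divide norm_power norm_mult intro!: divide_right_mono power_mono)
    show "summable (\<lambda>m. pi ^ m / fact m)"
      using summable_exp[of pi] by (simp add: divide_inverse mult.commute)
  qed
  moreover have "(\<Sum>m. (\<i> * of_real t) ^ m / fact m) = cis t" for t
    unfolding cis_conv_exp exp_def
    by (rule suminf_cong) (simp add: scaleR_conv_of_real divide_inverse mult.commute)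
  ultimately show ?thesis
    by simp
qed

theorem theorem2p1:
  shows "(\<forall>m\<ge>1. conv_power tau m \<in> l2) \<and>
         l2_sums (\<lambda>m n. conv_power tau m n / fact m) (q_power 1)"
proof -
  let ?s = "\<lambda>m t. (\<i> * of_real t) ^ m / fact m"
  have cont: "continuous_on {-pi..pi} (?s m)" for m
    by (intro continuous_intros) auto
  have coeffs: "(\<lambda>n. conv_power tau m n / fact m) = fourier_coeff (?s m)" for m
    using fourier_coeff_cmult[of "1 / fact m" "\<lambda>t. (\<i> * of_real t) ^ m"]
    by (simp add: conv_power_tau fun_eq_iff)
  have q: "q_power 1 = fourier_coeff cis"
    using fourier_coeff_cis[of 1] by simp
  \<comment> \<open>By linearity the error in \<open>l2\<close> is the coefficient sequence of the
    uniform error of the exponential series.\<close>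
  have diff: "(\<lambda>n. (\<Sum>m<N. conv_power tau m n / fact m) - q_power 1 n) =
      fourier_coeff (\<lambda>t. (\<Sum>m<N. ?s m t) - cis t)" for N
  proof
    fix n
    have "continuous_on {-pi..pi} (\<lambda>t. \<Sum>m<N. ?s m t)"
      by (intro continuous_on_sum cont)
    moreover have "continuous_on {-pi..pi} cis"
      using continuous_on_cis[OF continuous_on_id] by simp
    ultimately show "(\<Sum>m<N. conv_power tau m n / fact m) - q_power 1 n =
        fourier_coeff (\<lambda>t. (\<Sum>m<N. ?s m t) - cis t) n"
      using coeffs by (simp only: fourier_coeff_diff fourier_coeff_sum[OF finite_lessThan cont] q fun_eq_iff)
  qed
  have "(\<lambda>N. l2_norm (fourier_coeff (\<lambda>t. (\<Sum>m<N. ?s m t) - cis t))) \<longlonglongrightarrow> 0"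
  proof (rule LIMSEQ_I)
    fix e :: real assume "e > 0"
    \<comment> \<open>Half of \<open>e\<close>, because the norm estimate gives only a non-strict
      bound.\<close>
    then have "\<forall>\<^sub>F N in sequentially. \<forall>t\<in>{-pi..pi}. dist (\<Sum>m<N. ?s m t) (cis t) < e / 2"
      using uniform_limitD[OF uniform_limit_cis_series, of "e / 2"] by simp
    then have "\<forall>\<^sub>F N in sequentially. l2_norm (fourier_coeff (\<lambda>t. (\<Sum>m<N. ?s m t) - cis t)) \<le> e / 2"
    proof eventually_elim
      case (elim N)
      then show ?case using \<open>e > 0\<close>
        by (intro l2_norm_fourier_coeff_le continuous_intros cont) (auto simp: dist_norm less_imp_le)
    qed
    moreover have "0 \<le> l2_norm \<psi>" for \<psi>
      by (simp add: l2_norm_def infsum_nonneg)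
    ultimately show "\<exists>N0. \<forall>N\<ge>N0.
        norm (l2_norm (fourier_coeff (\<lambda>t. (\<Sum>m<N. ?s m t) - cis t)) - 0) < e"
      using \<open>e > 0\<close> unfolding eventually_sequentially by fastforce
  qed
  then show ?thesis
    unfolding l2_sums_def diff unfolding coeffs q unfolding conv_power_tau
    by (intro conjI allI impI fourier_coeff_in_l2 cont continuous_intros)
qed

end
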